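(* Let $\tau\geq\aleph_0$ be a cardinal and let $P$ and $K$ be compact subsets of $\mathbb N^\tau$. Then every homeomorphism between $P$ and $K$ can be extended to a homeomorphism of $\mathbb N^\tau$ onto itself.
   Context: $\mathbb N$ denotes the countable infinite discrete space and $\mathbb N^\tau$ its $\tau$-th power with the product topology. *)

theory Defs
  imports "HOL-Analysis.Analysis"
begin

text \<open>The power of the countable discrete space over an index set \<^term>\<open>I\<close>. Its points are the
  functions in \<^term>\<open>I \<rightarrow>\<^sub>E (UNIV :: nat set)\<close>, and up to homeomorphism it depends only on the
  cardinality of \<^term>\<open>I\<close>.\<close>

abbreviation nat_power :: "'i set \<Rightarrow> ('i \<Rightarrow> nat) topology" where
  "nat_power I \<equiv> product_topology (\<lambda>_. discrete_topology (UNIV :: nat set)) I"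

end

theory Submission
  imports Defs
begin

text \<open>The proof is Klee's shearing trick. View one factor \<open>\<nat>\<close> as the countable set \<open>\<int> \<times> \<int>\<close>.
  A compact set \<open>P\<close> has finite projections to the discrete factors, so the bijections
  \<open>\<nat> \<rightarrow> \<int> \<times> \<int>\<close> can be chosen, one for each index, to carry these projections into \<open>\<int> \<times> {0}\<close>; their
  product is a homeomorphism from the power of \<open>\<nat>\<close> onto \<open>X \<times> X\<close>, where \<open>X\<close> is the same power of
  \<open>\<int>\<close>, and it moves \<open>P\<close> into \<open>X \<times> {0}\<close> (lemma \<open>compact_to_zero_section\<close>). The same is done for \<open>K\<close>.

  It remains to extend a homeomorphism \<open>f\<close> between compact sets \<open>A\<close> and \<open>B\<close> of the group \<open>X\<close>, placed
  in \<open>X \<times> {0}\<close>. A continuous map from a compact subset of \<open>X\<close> to \<open>X\<close> extends to all of \<open>X\<close>, because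
  each of its coordinates depends on only finitely many coordinates of the argument
  (lemma \<open>compact_finitely_determined\<close>). Let \<open>F\<close> and \<open>G\<close> extend \<open>f\<close> and its inverse. The
  shears \<open>(a, b) \<mapsto> (a, b + F a)\<close> and \<open>(a, b) \<mapsto> (a - G b, b)\<close> are homeomorphisms of \<open>X \<times> X\<close>, and
  for \<open>a\<close> in \<open>A\<close> they move \<open>(a, 0)\<close> to \<open>(a, f a)\<close> and then to \<open>(0, f a)\<close>. Exchanging the
  two factors finishes the construction (lemma \<open>Klee_extension\<close>).\<close>

section \<open>Extending maps from compact sets\<close>

abbreviation discrete_power :: "'i set \<Rightarrow> ('i \<Rightarrow> 'a) topology" where
  "discrete_power I \<equiv> product_topology (\<lambda>_. discrete_topology UNIV) I"

lemma openin_discrete_power_cylinder: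
  assumes "finite J" "J \<subseteq> I"
  shows "openin (discrete_power I) {y \<in> extensional I. \<forall>j\<in>J. y j = x j}"
proof -
  have "{y \<in> extensional I. \<forall>j\<in>J. y j = x j}
      = (\<Pi>\<^sub>E i\<in>I. if i \<in> J then {x i} else UNIV)"
    using assms(2) by (auto simp: PiE_iff extensional_def split: if_splits)
  moreover have "openin (discrete_power I) (\<Pi>\<^sub>E i\<in>I. if i \<in> J then {x i} else UNIV)"
    by (rule product_topology_basis) (auto intro: finite_subset[OF _ assms(1)])
  ultimately show ?thesis
    by simp
qed

lemma discrete_power_cylinder_within:
  assumes "openin (discrete_power I) U" "x \<in> U"
  obtains J where "finite J" "J \<subseteq> I" "{y \<in> extensional I. \<forall>j\<in>J. y j = x j} \<subseteq> U"
proof -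
  from product_topology_open_contains_basis[OF assms] obtain X where
    X: "x \<in> Pi\<^sub>E I X" "finite {i. X i \<noteq> topspace (discrete_topology UNIV)}" "Pi\<^sub>E I X \<subseteq> U"
    by blast
  show thesis
  proof
    show "finite ({i. X i \<noteq> UNIV} \<inter> I)"
      using X(2) by simp
    show "{y \<in> extensional I. \<forall>j\<in>{i. X i \<noteq> UNIV} \<inter> I. y j = x j} \<subseteq> U"
    proof
      fix y
      assume y: "y \<in> {y \<in> extensional I. \<forall>j\<in>{i. X i \<noteq> UNIV} \<inter> I. y j = x j}"
      have "y i \<in> X i" if "i \<in> I" for i
        using X(1) y that by (cases "X i = UNIV") (simp_all add: PiE_iff)
      then have "y \<in> Pi\<^sub>E I X"
        using y by (simp add: PiE_iff)
      then show "y \<in> U"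
        using X(3) by (rule subsetD[rotated])
    qed
  qed simp
qed

text \<open>Near each point the map is constant on a cylinder that fixes finitely many coordinates; finitely
  many of these cylinders cover the compact set, and together they fix finitely many coordinates.\<close>

lemma compact_finitely_determined:
  fixes u :: "('i \<Rightarrow> 'a) \<Rightarrow> 'b"
  assumes C: "compactin (discrete_power I) C"
    and u: "continuous_map (subtopology (discrete_power I) C) (discrete_topology UNIV) u"
  obtains J where "finite J" "J \<subseteq> I"
    "\<And>x y. x \<in> C \<Longrightarrow> y \<in> C \<Longrightarrow> (\<And>j. j \<in> J \<Longrightarrow> x j = y j) \<Longrightarrow> u x = u y"
proof -
  have CE: "C \<subseteq> extensional I"
    using compactin_subset_topspace[OF C] by (auto simp: PiE_iff)
  define cyl where "cyl J x = {y \<in> extensional I. \<forall>j\<in>J. y j = x j}" for J and x :: "'i \<Rightarrow> 'a"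
  have "\<exists>J. finite J \<and> J \<subseteq> I \<and> (\<forall>y\<in>cyl J x \<inter> C. u y = u x)" if "x \<in> C" for x
  proof -
    have "openin (subtopology (discrete_power I) C)
        {y \<in> topspace (subtopology (discrete_power I) C). u y \<in> {u x}}"
      using u by (rule openin_continuous_map_preimage) simp
    then obtain U where U: "openin (discrete_power I) U"
      "{y \<in> topspace (subtopology (discrete_power I) C). u y \<in> {u x}} = U \<inter> C"
      by (auto simp: openin_subtopology)
    have "x \<in> U"
      using U(2) that compactin_subset_topspace[OF C] by auto
    then obtain J where "finite J" "J \<subseteq> I" "cyl J x \<subseteq> U"
      unfolding cyl_def by (rule discrete_power_cylinder_within[OF U(1)])
    then show ?thesis
      using U(2) by blast
  qed
  then obtain J where J: "\<And>x. x \<in> C \<Longrightarrow> finite (J x)" "\<And>x. x \<in> C \<Longrightarrow> J x \<subseteq> I"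
    "\<And>x y. x \<in> C \<Longrightarrow> y \<in> cyl (J x) x \<Longrightarrow> y \<in> C \<Longrightarrow> u y = u x"
    by (metis Int_iff)
  have "\<exists>\<F>. finite \<F> \<and> \<F> \<subseteq> (\<lambda>x. cyl (J x) x) ` C \<and> C \<subseteq> \<Union>\<F>"
  proof (rule compactinD[OF C])
    show "openin (discrete_power I) V" if "V \<in> (\<lambda>x. cyl (J x) x) ` C" for V
      using that openin_discrete_power_cylinder[OF J(1,2)] unfolding cyl_def by blast
    show "C \<subseteq> \<Union> ((\<lambda>x. cyl (J x) x) ` C)"
      using CE by (auto simp: cyl_def)
  qed
  then obtain \<F> where \<F>: "finite \<F>" "\<F> \<subseteq> (\<lambda>x. cyl (J x) x) ` C" "C \<subseteq> \<Union>\<F>"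
    by blast
  from finite_subset_image[OF \<F>(1,2)] \<F>(3)
  obtain D where D: "finite D" "D \<subseteq> C" "C \<subseteq> (\<Union>x\<in>D. cyl (J x) x)"
    by auto
  show thesis
  proof
    show "finite (\<Union>x\<in>D. J x)"
      using D(1,2) J(1) by (intro finite_UN_I) (simp_all add: subset_iff)
    show "(\<Union>x\<in>D. J x) \<subseteq> I"
      using D(2) J(2) by blast
    fix x y
    assume xy: "x \<in> C" "y \<in> C" "\<And>j. j \<in> (\<Union>x\<in>D. J x) \<Longrightarrow> x j = y j"
    from xy(1) D obtain z where z: "z \<in> D" "x \<in> cyl (J z) z"
      by blast
    have "x j = y j" if "j \<in> J z" for j
      using xy(3) z(1) that by blast
    then have "y \<in> cyl (J z) z"
      using z(2) xy(2) CE unfolding cyl_def by auto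
    moreover have "z \<in> C"
      using z D by blast
    ultimately show "u x = u y"
      using J(3)[of z x] J(3)[of z y] z(2) xy(1,2) by simp
  qed
qed

lemma compact_extend_to_discrete:
  fixes u :: "('i \<Rightarrow> 'a) \<Rightarrow> 'b"
  assumes C: "compactin (discrete_power I) C"
    and u: "continuous_map (subtopology (discrete_power I) C) (discrete_topology UNIV) u"
  obtains U where "continuous_map (discrete_power I) (discrete_topology UNIV) U"
    "\<And>x. x \<in> C \<Longrightarrow> U x = u x"
proof -
  obtain J where J: "finite J" "J \<subseteq> I"
    "\<And>x y. x \<in> C \<Longrightarrow> y \<in> C \<Longrightarrow> (\<And>j. j \<in> J \<Longrightarrow> x j = y j) \<Longrightarrow> u x = u y"
    using compact_finitely_determined[OF C u] by blast
  \<comment> \<open>The extension reads only the coordinates in \<open>J\<close>: it copies the value at a point of \<open>C\<close> with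
    these coordinates, and is an arbitrary constant where no such point exists.\<close>
  define U where "U x = u (SOME y. y \<in> C \<and> (\<forall>j\<in>J. y j = x j))" for x
  have U_cong: "U x = U y" if "\<forall>j\<in>J. x j = y j" for x y
    unfolding U_def using that by simp
  show thesis
  proof
    show "continuous_map (discrete_power I) (discrete_topology UNIV) U"
      unfolding continuous_map
    proof (intro conjI allI impI)
      fix V :: "'b set"
      show "openin (discrete_power I) {x \<in> topspace (discrete_power I). U x \<in> V}"
      proof (subst openin_subopen, intro ballI)
        fix x
        assume x: "x \<in> {x \<in> topspace (discrete_power I). U x \<in> V}"
        have "{y \<in> extensional I. \<forall>j\<in>J. y j = x j} \<subseteq> {x \<in> topspace (discrete_power I). U x \<in> V}"
          using x U_cong by (fastforce simp: PiE_iff)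
        then show "\<exists>T. openin (discrete_power I) T \<and> x \<in> T
            \<and> T \<subseteq> {x \<in> topspace (discrete_power I). U x \<in> V}"
          using x openin_discrete_power_cylinder[OF J(1,2), of x]
          by (intro exI[of _ "{y \<in> extensional I. \<forall>j\<in>J. y j = x j}"]) (auto simp: PiE_iff)
      qed
    qed auto
    fix x assume x: "x \<in> C"
    have "(SOME y. y \<in> C \<and> (\<forall>j\<in>J. y j = x j)) \<in> C
        \<and> (\<forall>j\<in>J. (SOME y. y \<in> C \<and> (\<forall>j\<in>J. y j = x j)) j = x j)"
      by (rule someI[of _ x]) (use x in simp)
    then show "U x = u x"
      unfolding U_def using J(3)[OF _ x] by blast
  qed
qed

lemma compact_extend_to_power:
  fixes f :: "('i \<Rightarrow> 'a) \<Rightarrow> ('k \<Rightarrow> 'b)"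
  assumes C: "compactin (discrete_power I) C"
    and f: "continuous_map (subtopology (discrete_power I) C) (discrete_power L) f"
  obtains F where "continuous_map (discrete_power I) (discrete_power L) F"
    "\<And>x. x \<in> C \<Longrightarrow> F x = f x"
proof -
  have "\<exists>U. continuous_map (discrete_power I) (discrete_topology UNIV) U \<and> (\<forall>x\<in>C. U x = f x l)"
    if "l \<in> L" for l
  proof -
    have "continuous_map (subtopology (discrete_power I) C) (discrete_topology UNIV) (\<lambda>x. f x l)"
      using f that by (auto simp: continuous_map_componentwise)
    from compact_extend_to_discrete[OF C this] show ?thesis
      by metis
  qed
  then obtain U where U: "\<And>l. l \<in> L \<Longrightarrow> continuous_map (discrete_power I) (discrete_topology UNIV) (U l)"
    "\<And>l x. l \<in> L \<Longrightarrow> x \<in> C \<Longrightarrow> U l x = f x l"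
    by metis
  show thesis
  proof
    show "continuous_map (discrete_power I) (discrete_power L) (\<lambda>x. \<lambda>l\<in>L. U l x)"
      using U(1) by (auto simp: continuous_map_componentwise)
    fix x assume x: "x \<in> C"
    then have "x \<in> topspace (subtopology (discrete_power I) C)"
      using compactin_subset_topspace[OF C] by auto
    then have "f x \<in> extensional L"
      using f by (auto simp: continuous_map_componentwise)
    then show "(\<lambda>l\<in>L. U l x) = f x"
      using U(2) x by (auto simp: fun_eq_iff extensional_def)
  qed
qed

section \<open>Shears of the square of an integer power\<close>

lemma continuous_map_discrete_binop:
  fixes u :: "'x \<Rightarrow> 'a" and v :: "'x \<Rightarrow> 'b" and h :: "'a \<Rightarrow> 'b \<Rightarrow> 'c"
  assumes "continuous_map X (discrete_topology UNIV) u"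
    and "continuous_map X (discrete_topology UNIV) v"
  shows "continuous_map X (discrete_topology UNIV) (\<lambda>x. h (u x) (v x))"
proof -
  have "continuous_map X (discrete_topology (UNIV :: ('a \<times> 'b) set)) (\<lambda>x. (u x, v x))"
    using assms continuous_map_pairedI[of X "discrete_topology UNIV" u "discrete_topology UNIV" v]
    by (simp flip: prod_topology_discrete_topology)
  moreover have "continuous_map (discrete_topology UNIV) (discrete_topology UNIV) (\<lambda>(a, b). h a b)"
    by simp
  ultimately have "continuous_map X (discrete_topology UNIV) ((\<lambda>(a, b). h a b) \<circ> (\<lambda>x. (u x, v x)))"
    by (rule continuous_map_compose)
  then show ?thesis
    by (simp add: o_def)
qed

lemma continuous_map_power_binop:
  fixes u :: "'x \<Rightarrow> ('i \<Rightarrow> 'a)" and v :: "'x \<Rightarrow> ('i \<Rightarrow> 'b)" and h :: "'i \<Rightarrow> 'a \<Rightarrow> 'b \<Rightarrow> 'c"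
  assumes "continuous_map X (discrete_power I) u" "continuous_map X (discrete_power I) v"
  shows "continuous_map X (discrete_power I) (\<lambda>x. \<lambda>i\<in>I. h i (u x i) (v x i))"
proof -
  have "continuous_map X (discrete_topology UNIV) (\<lambda>x. h i (u x i) (v x i))" if "i \<in> I" for i
    by (rule continuous_map_discrete_binop)
      (use assms that in \<open>simp_all add: continuous_map_componentwise\<close>)
  then show ?thesis
    by (simp add: continuous_map_componentwise image_subset_iff)
qed

abbreviation power_square :: "'i set \<Rightarrow> (('i \<Rightarrow> int) \<times> ('i \<Rightarrow> int)) topology" where
  "power_square I \<equiv> prod_topology (discrete_power I) (discrete_power I)"

lemma shear_homeomorphic:
  assumes F: "continuous_map (discrete_power I) (discrete_power I) F"
  shows "homeomorphic_maps (power_square I) (power_square I)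
    (\<lambda>(a, b). (a, \<lambda>i\<in>I. b i + F a i)) (\<lambda>(a, b). (a, \<lambda>i\<in>I. b i - F a i))"
proof -
  have F': "continuous_map (power_square I) (discrete_power I) (\<lambda>z. F (fst z))"
    using continuous_map_compose[OF continuous_map_fst F] by (simp add: o_def)
  have "continuous_map (power_square I) (power_square I)
      (\<lambda>z. (fst z, \<lambda>i\<in>I. h (snd z i) (F (fst z) i)))"
    for h :: "int \<Rightarrow> int \<Rightarrow> int"
    by (rule continuous_map_pairedI[OF continuous_map_fst
          continuous_map_power_binop[OF continuous_map_snd F']])
  note cont = this[of "(+)"] this[of "(-)"]
  have inv: "(\<lambda>i\<in>I. (\<lambda>i\<in>I. b i + c i) i - c i) = b" "(\<lambda>i\<in>I. (\<lambda>i\<in>I. b i - c i) i + c i) = b"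
    if "b \<in> extensional I" for b c :: "'a \<Rightarrow> int"
    using that by (simp_all add: fun_eq_iff extensional_def)
  show ?thesis
    unfolding homeomorphic_maps_def
  proof (intro conjI ballI)
    fix z
    assume "z \<in> topspace (power_square I)"
    then have "snd z \<in> extensional I"
      by (auto simp: PiE_iff)
    then show "(case case z of (a, b) \<Rightarrow> (a, \<lambda>i\<in>I. b i + F a i) of (a, b) \<Rightarrow> (a, \<lambda>i\<in>I. b i - F a i)) = z"
      "(case case z of (a, b) \<Rightarrow> (a, \<lambda>i\<in>I. b i - F a i) of (a, b) \<Rightarrow> (a, \<lambda>i\<in>I. b i + F a i)) = z"
      by (simp_all add: case_prod_unfold inv del: restrict_apply)
  qed (use cont in \<open>simp_all only: case_prod_unfold\<close>)
qed

lemma swap_homeomorphic: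
  "homeomorphic_maps (prod_topology X X) (prod_topology X X) prod.swap prod.swap"
proof -
  have "continuous_map (prod_topology X X) (prod_topology X X) prod.swap"
    using continuous_map_pairedI[OF continuous_map_snd[of X X] continuous_map_fst[of X X]]
    by (simp only: prod.swap_def[abs_def])
  then show ?thesis
    unfolding homeomorphic_maps_def by simp
qed

text \<open>The exchange of factors is placed between the two shears, so that both of them change the second
  coordinate: \<open>(a, 0)\<close> moves to \<open>(a, f a)\<close>, to \<open>(f a, a)\<close>, and to \<open>(f a, a - g (f a)) = (f a, 0)\<close>.\<close>

lemma Klee_extension:
  assumes A: "compactin (discrete_power I) A" and B: "compactin (discrete_power I) B"
    and fg: "homeomorphic_maps (subtopology (discrete_power I) A) (subtopology (discrete_power I) B) f g"
  obtains H where "homeomorphic_map (power_square I) (power_square I) H"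
    "\<And>a. a \<in> A \<Longrightarrow> H (a, \<lambda>i\<in>I. 0) = (f a, \<lambda>i\<in>I. 0)"
proof -
  have "continuous_map (subtopology (discrete_power I) A) (discrete_power I) f"
    "continuous_map (subtopology (discrete_power I) B) (discrete_power I) g"
    using fg by (auto simp: homeomorphic_maps_def continuous_map_in_subtopology)
  note f = this(1) and g = this(2)
  obtain F where
    F: "continuous_map (discrete_power I) (discrete_power I) F" "\<And>x. x \<in> A \<Longrightarrow> F x = f x"
    using compact_extend_to_power[OF A f] by blast
  obtain G where
    G: "continuous_map (discrete_power I) (discrete_power I) G" "\<And>x. x \<in> B \<Longrightarrow> G x = g x"
    using compact_extend_to_power[OF B g] by blast
  let ?S = "\<lambda>(a, b). (a, \<lambda>i\<in>I. b i + F a i)"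
  let ?T = "\<lambda>(a, b). (a, \<lambda>i\<in>I. b i - G a i)"
  have S: "homeomorphic_map (power_square I) (power_square I) ?S"
    by (rule homeomorphic_maps_imp_map[OF shear_homeomorphic[OF F(1)]])
  have T: "homeomorphic_map (power_square I) (power_square I) ?T"
    using shear_homeomorphic[OF G(1)] by (simp only: homeomorphic_maps_map)
  have hom: "homeomorphic_map (power_square I) (power_square I) (?T \<circ> (prod.swap \<circ> ?S))"
    by (rule homeomorphic_map_compose[OF
          homeomorphic_map_compose[OF S homeomorphic_maps_imp_map[OF swap_homeomorphic]] T])
  show thesis
  proof (rule that[OF hom])
    fix a assume a: "a \<in> A"
    have a': "a \<in> topspace (subtopology (discrete_power I) A)"
      using a compactin_subset_topspace[OF A] by auto
    then have fa: "f a \<in> topspace (subtopology (discrete_power I) B)" "g (f a) = a"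
      using fg by (auto simp: homeomorphic_maps_def continuous_map_def)
    then have "restrict (F a) I = f a" "G (f a) = a"
      using F(2)[OF a] G(2)[of "f a"] by (simp_all add: PiE_iff extensional_restrict)
    then show "(?T \<circ> (prod.swap \<circ> ?S)) (a, \<lambda>i\<in>I. 0) = (f a, \<lambda>i\<in>I. 0)"
      by (simp cong: restrict_cong)
  qed
qed

section \<open>Moving a compact set into the zero section\<close>

text \<open>A bijection from a finite set onto a part of \<open>\<int> \<times> {0}\<close> of the same size extends, because both
  complements are countably infinite.\<close>

lemma finite_to_zero_section:
  assumes "finite (B :: nat set)"
  obtains \<phi> :: "nat \<Rightarrow> int \<times> int" where "bij \<phi>" "\<And>n. n \<in> B \<Longrightarrow> snd (\<phi> n) = 0"
proof -
  have "infinite ((UNIV :: int set) \<times> {0 :: int})"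
    by (simp add: finite_cartesian_product_iff infinite_UNIV_int)
  then obtain D where D: "finite D" "card D = card B" "D \<subseteq> (UNIV :: int set) \<times> {0 :: int}"
    by (meson infinite_arbitrarily_large)
  obtain p where p: "bij_betw p B D"
    using assms D by (metis finite_same_card_bij)
  have "infinite (UNIV :: (int \<times> int) set)"
    by (simp add: finite_prod infinite_UNIV_int)
  then have "infinite (- B)" "infinite (- D)"
    using assms D(1) by (simp_all add: finite_compl)
  then have "bij_betw (to_nat_on (- B)) (- B) UNIV"
    "bij_betw (from_nat_into (- D)) UNIV (- D)"
    by (simp_all add: to_nat_on_infinite bij_betw_from_nat_into)
  then obtain q where q: "bij_betw q (- B) (- D)"
    using bij_betw_trans by blast
  show thesis
  proof
    have "bij_betw (\<lambda>n. if n \<in> B then p n else q n) (B \<union> - B) (D \<union> - D)"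
      using p q by (intro bij_betw_disjoint_Un) auto
    then show "bij (\<lambda>n. if n \<in> B then p n else q n)"
      by simp
    show "snd (if n \<in> B then p n else q n) = 0" if "n \<in> B" for n
      using that bij_betwE[OF p] D(3) by auto
  qed
qed

lemma product_bijection_homeomorphic:
  fixes \<phi> :: "'i \<Rightarrow> nat \<Rightarrow> int \<times> int"
  assumes "\<And>i. i \<in> I \<Longrightarrow> bij (\<phi> i)"
  shows "homeomorphic_maps (nat_power I) (power_square I)
    (\<lambda>x. (\<lambda>i\<in>I. fst (\<phi> i (x i)), \<lambda>i\<in>I. snd (\<phi> i (x i))))
    (\<lambda>(a, b). \<lambda>i\<in>I. inv (\<phi> i) (a i, b i))"
proof -
  have "continuous_map (nat_power I) (discrete_power I) (\<lambda>x. x)"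
    by simp
  then have "continuous_map (nat_power I) (power_square I)
      (\<lambda>x. (\<lambda>i\<in>I. fst (\<phi> i (x i)), \<lambda>i\<in>I. snd (\<phi> i (x i))))"
    by (intro continuous_map_pairedI
        continuous_map_power_binop[where v = "\<lambda>x. x" and h = "\<lambda>i n _. fst (\<phi> i n)"]
        continuous_map_power_binop[where v = "\<lambda>x. x" and h = "\<lambda>i n _. snd (\<phi> i n)"])
  moreover have "continuous_map (power_square I) (nat_power I)
      (\<lambda>z. \<lambda>i\<in>I. inv (\<phi> i) (fst z i, snd z i))"
    by (rule continuous_map_power_binop[OF continuous_map_fst continuous_map_snd])
  moreover have "inv (\<phi> i) (\<phi> i n) = n" "\<phi> i (inv (\<phi> i) z) = z" if "i \<in> I" for i n z
    using assms[OF that] by (simp_all add: bij_is_inj bij_is_surj surj_f_inv_f)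
  ultimately show ?thesis
    unfolding homeomorphic_maps_def
    by (simp add: case_prod_unfold PiE_iff extensional_restrict cong: restrict_cong)
qed

text \<open>Each factor is discrete, so the projection of a compact set to it is finite, and a bijection as in
  \<open>finite_to_zero_section\<close> can be chosen for each index.\<close>

lemma compact_to_zero_section:
  assumes P: "compactin (nat_power I) P"
  obtains h where "homeomorphic_map (nat_power I) (power_square I) h"
    "\<And>x. x \<in> P \<Longrightarrow> snd (h x) = (\<lambda>i\<in>I. 0)"
proof -
  have "finite ((\<lambda>x. x i) ` P)" if "i \<in> I" for i
  proof -
    have "compactin (discrete_topology (UNIV :: nat set)) ((\<lambda>x. x i) ` P)"
      using P by (rule image_compactin) (rule continuous_map_product_projection[OF that])
    then show ?thesis
      by (simp add: compactin_discrete_topology)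
  qed
  then have "\<exists>\<phi> :: nat \<Rightarrow> int \<times> int. bij \<phi> \<and> (\<forall>x\<in>P. snd (\<phi> (x i)) = 0)" if "i \<in> I" for i
    using that finite_to_zero_section by (metis imageI)
  then obtain \<phi> :: "'a \<Rightarrow> nat \<Rightarrow> int \<times> int" where
    \<phi>: "\<And>i. i \<in> I \<Longrightarrow> bij (\<phi> i)" "\<And>i x. i \<in> I \<Longrightarrow> x \<in> P \<Longrightarrow> snd (\<phi> i (x i)) = 0"
    by metis
  show thesis
  proof (rule that)
    show "homeomorphic_map (nat_power I) (power_square I)
        (\<lambda>x. (\<lambda>i\<in>I. fst (\<phi> i (x i)), \<lambda>i\<in>I. snd (\<phi> i (x i))))"
      by (rule homeomorphic_maps_imp_map[OF product_bijection_homeomorphic[OF \<phi>(1)]])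
    show "snd (\<lambda>i\<in>I. fst (\<phi> i (x i)), \<lambda>i\<in>I. snd (\<phi> i (x i))) = (\<lambda>i\<in>I. 0)" if "x \<in> P" for x
      using \<phi>(2) that by (auto simp: fun_eq_iff)
  qed
qed

section \<open>Extension of homeomorphisms\<close>

text \<open>On a zero section the projection \<open>X \<times> X \<rightarrow> X\<close> is inverted by the continuous map
  \<open>a \<mapsto> (a, 0)\<close>; so a compact set moved there can be studied as a subset of \<open>X\<close>.\<close>

lemma compact_zero_section_coordinates:
  assumes P: "compactin (nat_power I) P"
  obtains h p q where "homeomorphic_map (nat_power I) (power_square I) h"
    "\<And>x. x \<in> P \<Longrightarrow> h x = (p x, \<lambda>i\<in>I. 0)"
    "compactin (discrete_power I) (p ` P)"
    "homeomorphic_maps (subtopology (nat_power I) P) (subtopology (discrete_power I) (p ` P)) p q"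
proof -
  obtain h where h: "homeomorphic_map (nat_power I) (power_square I) h"
    "\<And>x. x \<in> P \<Longrightarrow> snd (h x) = (\<lambda>i\<in>I. 0)"
    using compact_to_zero_section[OF P] by blast
  then obtain k where hk: "homeomorphic_maps (nat_power I) (power_square I) h k"
    by (auto simp: homeomorphic_map_maps)
  let ?p = "\<lambda>x. fst (h x)" and ?q = "\<lambda>a. k (a, \<lambda>i\<in>I. 0)"
  have hp: "h x = (?p x, \<lambda>i\<in>I. 0)" if "x \<in> P" for x
    using h(2)[OF that] by (metis prod.collapse)
  have p: "continuous_map (nat_power I) (discrete_power I) ?p"
  proof -
    have "continuous_map (nat_power I) (power_square I) h"
      using hk by (simp only: homeomorphic_maps_def)
    from continuous_map_compose[OF this continuous_map_fst] show ?thesis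
      by (simp only: o_def)
  qed
  have "continuous_map (discrete_power I) (power_square I) (\<lambda>a. (a, \<lambda>i\<in>I. 0))"
    by (intro continuous_map_pairedI) (auto simp: continuous_map_componentwise)
  then have q: "continuous_map (discrete_power I) (nat_power I) ?q"
  proof -
    have "continuous_map (power_square I) (nat_power I) k"
      using hk by (simp only: homeomorphic_maps_def)
    from continuous_map_compose[OF \<open>continuous_map _ _ (\<lambda>a. (a, \<lambda>i\<in>I. 0))\<close> this] show ?thesis
      by (simp only: o_def)
  qed
  have qp: "?q (?p x) = x" if "x \<in> P" for x
  proof -
    have "x \<in> topspace (nat_power I)"
      using compactin_subset_topspace[OF P] that by blast
    then show ?thesis
      using hk hp[OF that] unfolding homeomorphic_maps_def by metis
  qed
  have "homeomorphic_maps (subtopology (nat_power I) P) (subtopology (discrete_power I) (?p ` P)) ?p ?q"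
    unfolding homeomorphic_maps_def continuous_map_in_subtopology
    using p q qp by (auto simp: continuous_map_from_subtopology)
  then show thesis
    by (rule that[rotated 3]) (use h(1) hp image_compactin[OF P p] in simp_all)
qed

theorem corollary1p2:
  fixes I :: "'i set"
    and P K :: "('i \<Rightarrow> nat) set"
    and f :: "('i \<Rightarrow> nat) \<Rightarrow> ('i \<Rightarrow> nat)"
  assumes "infinite I"
    and "compactin (nat_power I) P"
    and "compactin (nat_power I) K"
    and "homeomorphic_map (subtopology (nat_power I) P) (subtopology (nat_power I) K) f"
  shows "\<exists>F. homeomorphic_map (nat_power I) (nat_power I) F \<and> (\<forall>x\<in>P. F x = f x)"
proof -
  obtain h p p' where h: "homeomorphic_map (nat_power I) (power_square I) h"
    "\<And>x. x \<in> P \<Longrightarrow> h x = (p x, \<lambda>i\<in>I. 0)" "compactin (discrete_power I) (p ` P)"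
    "homeomorphic_maps (subtopology (nat_power I) P) (subtopology (discrete_power I) (p ` P)) p p'"
    using compact_zero_section_coordinates[OF assms(2)] by blast
  obtain k q q' where k: "homeomorphic_map (nat_power I) (power_square I) k"
    "\<And>x. x \<in> K \<Longrightarrow> k x = (q x, \<lambda>i\<in>I. 0)" "compactin (discrete_power I) (q ` K)"
    "homeomorphic_maps (subtopology (nat_power I) K) (subtopology (discrete_power I) (q ` K)) q q'"
    using compact_zero_section_coordinates[OF assms(3)] by blast
  obtain f' where f':
    "homeomorphic_maps (subtopology (nat_power I) P) (subtopology (nat_power I) K) f f'"
    using assms(4) by (auto simp: homeomorphic_map_maps)
  have "homeomorphic_maps (subtopology (discrete_power I) (p ` P))
      (subtopology (discrete_power I) (q ` K)) (q \<circ> (f \<circ> p')) ((p \<circ> f') \<circ> q')"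
    by (rule homeomorphic_maps_compose[OF conjI[OF
          homeomorphic_maps_compose[OF conjI[OF h(4)[THEN homeomorphic_maps_sym[THEN iffD1]] f']] k(4)]])
  then obtain H where H: "homeomorphic_map (power_square I) (power_square I) H"
    "\<And>a. a \<in> p ` P \<Longrightarrow> H (a, \<lambda>i\<in>I. 0) = ((q \<circ> (f \<circ> p')) a, \<lambda>i\<in>I. 0)"
    using Klee_extension[OF h(3) k(3)] by blast
  obtain k' where k': "homeomorphic_maps (nat_power I) (power_square I) k k'"
    using k(1) by (auto simp: homeomorphic_map_maps)
  then have "homeomorphic_map (power_square I) (nat_power I) k'"
    by (simp only: homeomorphic_maps_map)
  then have "homeomorphic_map (nat_power I) (nat_power I) (k' \<circ> (H \<circ> h))"
    by (rule homeomorphic_map_compose[OF homeomorphic_map_compose[OF h(1) H(1)]])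
  moreover have "(k' \<circ> (H \<circ> h)) x = f x" if x: "x \<in> P" for x
  proof -
    have xP: "x \<in> topspace (subtopology (nat_power I) P)"
      using x compactin_subset_topspace[OF assms(2)] by auto
    then have fx: "f x \<in> topspace (subtopology (nat_power I) K)"
      using f' by (auto simp: homeomorphic_maps_def continuous_map_def)
    have "p' (p x) = x"
      using h(4) xP by (auto simp: homeomorphic_maps_def)
    then have "H (h x) = k (f x)"
      using H(2)[of "p x"] h(2)[OF x] k(2)[of "f x"] fx x by auto
    then show ?thesis
      using k' fx by (auto simp: homeomorphic_maps_def)
  qed
  ultimately show ?thesis
    by blast
qed

end
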